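(* Let $X$ be an open convex subset of a Banach space with norm $\|\cdot\|$, and let $f:X\to\mathbb{R}$ be Fréchet differentiable at each point of $X$. Let $\gamma,b,\beta$ be real numbers with $\gamma>1$, $b>0$, $\beta\ge 0$, and put $\epsilon=(\gamma+1)(b+\beta)$. Let $\eta$ be a real random variable distributed according to $\mathit{GenCauchy}(\gamma)$. Let $c:X\to\mathbb{R}$ be a $\beta$-smooth upper bound on the derivative sensitivity $\mathrm{DS}_f$. Then the randomized mapping \[ g(\mathbf{x})=f(\mathbf{x})+\frac{c(\mathbf{x})}{b}\cdot\eta \] is $\epsilon$-differentially private with respect to the distance $d(\mathbf{x},\mathbf{x}')=\|\mathbf{x}-\mathbf{x}'\|$ on $X$.
   Context: Derivative sensitivity: $\mathrm{DS}_f(\mathbf{x})=\|df_{\mathbf{x}}\|$, the operator norm of the Fréchet derivative $df_{\mathbf{x}}$ of $f$ at $\mathbf{x}$. Smoothness: a map $p:X\to\mathbb{R}$ is $\beta$-smooth if $p(\mathbf{x})\le e^{\beta\|\mathbf{x}'-\mathbf{x}\|}\,p(\mathbf{x}')$ for all $\mathbf{x},\mathbf{x}'\in X$. A $\beta$-smooth upper bound on $\mathrm{DS}_f$ is a $\beta$-smooth map $c:X\to\mathbb{R}$ with $c(\mathbf{x})\ge \mathrm{DS}_f(\mathbf{x})$ for all $\mathbf{x}\in X$. Generalized Cauchy distribution: for $\gamma>1$, $\mathit{GenCauchy}(\gamma)$ is the probability distribution on $\mathbb{R}$ whose density at $t$ is proportional to $\frac{1}{1+|t|^\gamma}$. Differential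 privacy: a map $g$ from a metric space $(X,d)$ to probability distributions on $\mathbb{R}$ (here $g(\mathbf{x})$ is identified with the law of the random variable) is $\epsilon$-differentially private if for all measurable $Y'\subseteq\mathbb{R}$ and all $\mathbf{x},\mathbf{x}'\in X$ with $d(\mathbf{x},\mathbf{x}')=1$ one has $\Pr[g(\mathbf{x})\in Y']\le e^{\epsilon}\Pr[g(\mathbf{x}')\in Y']$. *)

theory Defs
  imports "HOL-Probability.Probability" "HOL-Real_Asymp.Real_Asymp"
begin

(* Meaningful only where f is differentiable: elsewhere frechet_derivative is unspecified. *)
definition derivative_sensitivity :: "('a::real_normed_vector \<Rightarrow> real) \<Rightarrow> 'a \<Rightarrow> real" where
  "derivative_sensitivity f x = onorm (frechet_derivative f (at x))"

definition smooth_on :: "'a::real_normed_vector set \<Rightarrow> real \<Rightarrow> ('a \<Rightarrow> real) \<Rightarrow> bool" where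
  "smooth_on X \<beta> p \<longleftrightarrow> (\<forall>x\<in>X. \<forall>x'\<in>X. p x \<le> exp (\<beta> * norm (x' - x)) * p x')"

definition smooth_upper_bound_on ::
  "'a::real_normed_vector set \<Rightarrow> real \<Rightarrow> ('a \<Rightarrow> real) \<Rightarrow> ('a \<Rightarrow> real) \<Rightarrow> bool" where
  "smooth_upper_bound_on X \<beta> h c \<longleftrightarrow> smooth_on X \<beta> c \<and> (\<forall>x\<in>X. h x \<le> c x)"

(* GenCauchy is the law density lborel (gen_cauchy_density gamma); see prob_space_gen_cauchy. *)
definition gen_cauchy_density :: "real \<Rightarrow> real \<Rightarrow> real" where
  "gen_cauchy_density \<gamma> t =
     (1 / (1 + \<bar>t\<bar> powr \<gamma>)) / (\<integral>u. 1 / (1 + \<bar>u\<bar> powr \<gamma>) \<partial>lborel)"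

lemma integrable_gen_cauchy:
  fixes \<gamma> :: real
  assumes "\<gamma> > 1"
  shows "integrable lborel (\<lambda>u::real. 1 / (1 + \<bar>u\<bar> powr \<gamma>))"
proof -
  let ?h = "\<lambda>u::real. indicator {0..} u * (1 + u) powr (- \<gamma>)"
  have lim: "((\<lambda>x::real. (1 + x) powr (1 - \<gamma>) / (1 - \<gamma>)) \<longlongrightarrow> 0) at_top"
    using assms by real_asymp
  have "(\<integral>\<^sup>+x. ennreal ((1 + x) powr (- \<gamma>)) * indicator {0..} x \<partial>lborel)
          = ennreal (0 - (1 + 0) powr (1 - \<gamma>) / (1 - \<gamma>))"
  proof (rule nn_integral_FTC_atLeast[OF _ _ _ lim])
    fix x :: real assume "0 \<le> x"
    then show "((\<lambda>x. (1 + x) powr (1 - \<gamma>) / (1 - \<gamma>)) has_real_derivative (1 + x) powr (- \<gamma>)) (at x)"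
      using assms DERIV_fun_powr[of "\<lambda>x. 1 + x" 1 x "1 - \<gamma>"]
      by (auto intro!: derivative_eq_intros DERIV_cdivide[THEN DERIV_cong])
  qed auto
  then have "(\<integral>\<^sup>+x. ennreal (norm (?h x)) \<partial>lborel) < \<infinity>"
    by (auto simp: ennreal_mult' mult.commute ennreal_indicator abs_mult)
  then have h: "integrable lborel ?h"
    by (intro integrableI_bounded) auto
  have h': "integrable lborel (\<lambda>u. ?h (- u))"
    using lborel_integrable_real_affine[OF h, of "-1" 0] by simp
  have "integrable lborel (\<lambda>u. 2 powr \<gamma> * (?h u + ?h (- u)))"
    by (intro integrable_mult_right Bochner_Integration.integrable_add h h')
  then show ?thesis
  proof (rule Bochner_Integration.integrable_bound)
    show "AE u in lborel. norm (1 / (1 + \<bar>u\<bar> powr \<gamma>)) \<le> norm (2 powr \<gamma> * (?h u + ?h (- u)))"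
    proof (intro AE_I2)
      fix u :: real
      have "(1 + \<bar>u\<bar>) powr \<gamma> \<le> (2 * max 1 \<bar>u\<bar>) powr \<gamma>"
        using assms by (intro powr_mono2) auto
      also have "\<dots> = 2 powr \<gamma> * max 1 \<bar>u\<bar> powr \<gamma>"
        by (simp add: powr_mult)
      also have "\<dots> \<le> 2 powr \<gamma> * (1 + \<bar>u\<bar> powr \<gamma>)"
        by (auto simp: max_def)
      finally have "1 / (1 + \<bar>u\<bar> powr \<gamma>) \<le> 2 powr \<gamma> * (1 + \<bar>u\<bar>) powr (- \<gamma>)"
        by (simp add: powr_minus field_simps add_pos_nonneg)
      also have "\<dots> \<le> 2 powr \<gamma> * (?h u + ?h (- u))"
        by (auto split: split_indicator)
      finally show "norm (1 / (1 + \<bar>u\<bar> powr \<gamma>)) \<le> norm (2 powr \<gamma> * (?h u + ?h (- u)))"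
        by auto
    qed
  qed auto
qed

lemma prob_space_gen_cauchy:
  assumes "\<gamma> > 1"
  shows "prob_space (density lborel (gen_cauchy_density \<gamma>))"
proof
  let ?k = "\<lambda>u::real. 1 / (1 + \<bar>u\<bar> powr \<gamma>)"
  have k: "?k u > 0" for u
    by (simp add: add_pos_nonneg)
  have int: "integrable lborel ?k"
    using integrable_gen_cauchy[OF assms] .
  have "(\<integral>u. ?k u \<partial>lborel) \<noteq> 0"
  proof
    assume "(\<integral>u. ?k u \<partial>lborel) = 0"
    then have "AE u in lborel. ?k u = 0"
      using integral_nonneg_eq_0_iff_AE[OF int] k by (auto simp: less_imp_le)
    then have "AE u in (lborel :: real measure). False"
      using k by (metis (mono_tags, lifting) eventually_mono less_irrefl)
    then show False
      using AE_iff_null_sets[of UNIV "lborel :: real measure"] by (simp add: null_sets_def)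
  qed
  then have pos: "(\<integral>u. ?k u \<partial>lborel) > 0"
    using Bochner_Integration.integral_nonneg[of lborel ?k] k by (simp add: less_le)
  have "emeasure (density lborel (gen_cauchy_density \<gamma>)) UNIV
          = (\<integral>\<^sup>+u. ennreal (?k u / (\<integral>u. ?k u \<partial>lborel)) \<partial>lborel)"
    by (subst emeasure_density) (auto simp: gen_cauchy_density_def[abs_def])
  also have "\<dots> = ennreal (\<integral>u. ?k u / (\<integral>u. ?k u \<partial>lborel) \<partial>lborel)"
    using pos k int
    by (intro nn_integral_eq_integral integrable_divide AE_I2 divide_nonneg_pos) (auto simp: less_imp_le)
  also have "\<dots> = 1"
    using pos by (subst integral_divide_zero) simp
  finally show "emeasure (density lborel (gen_cauchy_density \<gamma>))
      (space (density lborel (gen_cauchy_density \<gamma>))) = 1"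
    by simp
qed

(* g x is the law of the mechanism's output at x; d is meant to be a metric on X. *)
definition differentially_private ::
  "'a set \<Rightarrow> ('a \<Rightarrow> 'a \<Rightarrow> real) \<Rightarrow> real \<Rightarrow> ('a \<Rightarrow> real measure) \<Rightarrow> bool" where
  "differentially_private X d \<epsilon> g \<longleftrightarrow>
     (\<forall>x\<in>X. prob_space (g x) \<and> sets (g x) = sets borel) \<and>
     (\<forall>Y\<in>sets borel. \<forall>x\<in>X. \<forall>x'\<in>X. d x x' = 1 \<longrightarrow>
        measure (g x) Y \<le> exp \<epsilon> * measure (g x') Y)"

end

theory Submission
  imports Defs
begin

text \<open>
  Fix an output \<open>y\<close>; up to a constant, the negative logarithm of the density of \<open>g x\<close> at \<open>y\<close> is
  \<open>ln s + ln (1 + \<bar>(y - f x) / s\<bar> powr \<gamma>)\<close> with \<open>s = c x / b\<close>. As \<open>t \<mapsto> ln (1 + \<bar>t\<bar> powr \<gamma>)\<close> is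
  \<open>\<gamma>\<close>-Lipschitz, moving \<open>f x\<close> costs \<open>\<gamma>\<close> times the change of \<open>f\<close> relative to \<open>s\<close>, and changing the
  scale by a factor of \<open>exp l\<close> costs at most \<open>(\<gamma> + 1) * l\<close>. Over a step of length \<open>d\<close> these costs are
  at most \<open>\<gamma> * b * exp (\<beta> * d) * d\<close> (mean value inequality) and \<open>(\<gamma> + 1) * \<beta> * d\<close>. The superfluous factor
  \<open>exp (\<beta> * d)\<close> disappears when a unit segment is cut into \<open>n\<close> equal steps and \<open>n \<rightarrow> \<infinity>\<close>.
\<close>

section \<open>Passing from short steps to the unit interval\<close>

text \<open>Telescoping over \<open>Suc n\<close> equal steps gives the bound
  \<open>K (1 / real (Suc n))\<close> for every \<open>n\<close>; continuity of \<open>K\<close> at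
  0 then permits the limit.\<close>

lemma increment_le_of_small_steps:
  fixes \<phi> K :: "real \<Rightarrow> real"
  assumes step: "\<And>s t. 0 \<le> s \<Longrightarrow> s < t \<Longrightarrow> t \<le> 1 \<Longrightarrow> \<phi> t - \<phi> s \<le> K (t - s) * (t - s)"
    and K: "isCont K 0"
  shows "\<phi> 1 - \<phi> 0 \<le> K 0"
proof -
  have le: "\<phi> 1 - \<phi> 0 \<le> K (1 / real (Suc n))" for n
  proof -
    have "\<phi> 1 - \<phi> 0 = (\<Sum>i<Suc n. \<phi> (real (Suc i) / real (Suc n)) - \<phi> (real i / real (Suc n)))"
      by (subst sum_lessThan_telescope) simp
    also have "\<dots> \<le> (\<Sum>i<Suc n. K (1 / real (Suc n)) * (1 / real (Suc n)))"
    proof (rule sum_mono)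
      fix i assume "i \<in> {..<Suc n}"
      moreover have "real (Suc i) / real (Suc n) - real i / real (Suc n) = 1 / real (Suc n)"
        by (simp flip: diff_divide_distrib)
      ultimately show "\<phi> (real (Suc i) / real (Suc n)) - \<phi> (real i / real (Suc n))
          \<le> K (1 / real (Suc n)) * (1 / real (Suc n))"
        using step[of "real i / real (Suc n)" "real (Suc i) / real (Suc n)"]
        by (auto simp: divide_right_mono divide_strict_right_mono)
    qed
    also have "\<dots> = K (1 / real (Suc n))"
      by simp
    finally show ?thesis .
  qed
  have "(\<lambda>n. K (1 / real (Suc n))) \<longlonglongrightarrow> K 0"
    using LIMSEQ_Suc[OF lim_1_over_n] by (intro isCont_tendsto_compose[OF K]) simp
  then show ?thesis
    by (rule LIMSEQ_le_const) (use le in auto)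
qed

section \<open>Logarithmic estimates for the Cauchy profile\<close>

text \<open>At \<open>z > 0\<close> the derivative of \<open>ln (1 + z powr \<gamma>)\<close> is
  \<open>\<gamma> * z powr (\<gamma> - 1) / (1 + z powr \<gamma>)\<close>. It is at most \<gamma>,
  since \<open>z powr (\<gamma> - 1)\<close> is bounded by 1 for \<open>z \<le> 1\<close> and by
  \<open>z powr \<gamma>\<close> otherwise. Monotonicity and the reverse triangle inequality carry
  the bound over to absolute values.\<close>

lemma ln_one_plus_powr_lipschitz:
  fixes \<gamma> t u :: real
  assumes "\<gamma> \<ge> 1"
  shows "ln (1 + \<bar>t\<bar> powr \<gamma>) - ln (1 + \<bar>u\<bar> powr \<gamma>) \<le> \<gamma> * \<bar>t - u\<bar>"
proof -
  define k where "k v = ln (1 + v powr \<gamma>)" for v :: real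
  have pos: "1 + v powr \<gamma> > 0" for v :: real
    by (simp add: add_pos_nonneg)
  have *: "k w - k v \<le> \<gamma> * (w - v)" if "0 \<le> v" "v < w" for v w
  proof -
    \<comment> \<open>Differentiability is required only at interior points, where
      \<open>z > 0\<close>; this admits \<open>v = 0\<close>.\<close>
    have "\<exists>l z. v < z \<and> z < w \<and> (k has_real_derivative l) (at z) \<and> k w - k v = (w - v) * l"
    proof (rule MVT[OF \<open>v < w\<close>])
      have "continuous_on {v..w} (\<lambda>v. v powr \<gamma>)"
        using assms that by (intro continuous_on_powr') auto
      then show "continuous_on {v..w} k"
        unfolding k_def using pos
        by (intro continuous_on_ln continuous_on_add continuous_on_const) (auto simp: less_imp_neq[symmetric])
      fix z assume "v < z" "z < w"
      then have "(k has_real_derivative (\<gamma> * z powr (\<gamma> - 1)) / (1 + z powr \<gamma>)) (at z)"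
        unfolding k_def using that pos[of z] by (auto intro!: derivative_eq_intros)
      then show "k differentiable (at z)"
        using real_differentiable_def by blast
    qed
    then obtain l z where z: "v < z" "z < w" and l: "(k has_real_derivative l) (at z)"
      and eq: "k w - k v = (w - v) * l"
      by blast
    have "(k has_real_derivative (\<gamma> * z powr (\<gamma> - 1)) / (1 + z powr \<gamma>)) (at z)"
      unfolding k_def using that z pos[of z] by (auto intro!: derivative_eq_intros)
    then have "l = \<gamma> * (z powr (\<gamma> - 1) / (1 + z powr \<gamma>))"
      using l DERIV_unique by fastforce
    moreover have "z powr (\<gamma> - 1) \<le> 1 + z powr \<gamma>"
    proof (cases "z \<le> 1")
      case True
      then have "z powr (\<gamma> - 1) \<le> 1"
        using assms that z powr_mono2[of "\<gamma> - 1" z 1] by simp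
      then show ?thesis
        by (simp add: add_increasing2)
    next
      case False
      then have "z powr (\<gamma> - 1) \<le> z powr \<gamma>"
        by (intro powr_mono) auto
      then show ?thesis by simp
    qed
    ultimately have "l \<le> \<gamma> * 1"
      using assms pos[of z] by (simp only:) (intro mult_left_mono; simp)
    then show ?thesis
      using eq that mult_left_mono[of l \<gamma> "w - v"] by (simp add: mult.commute)
  qed
  have mono: "k v \<le> k w" if "0 \<le> v" "v \<le> w" for v w
    unfolding k_def using assms that pos by (simp add: powr_mono2)
  have "k \<bar>t\<bar> - k \<bar>u\<bar> \<le> \<gamma> * \<bar>t - u\<bar>"
  proof (cases "\<bar>u\<bar> < \<bar>t\<bar>")
    case True
    then have "k \<bar>t\<bar> - k \<bar>u\<bar> \<le> \<gamma> * (\<bar>t\<bar> - \<bar>u\<bar>)"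
      by (intro *) auto
    also have "\<dots> \<le> \<gamma> * \<bar>t - u\<bar>"
      using assms by (intro mult_left_mono) auto
    finally show ?thesis .
  next
    case False
    then have "k \<bar>t\<bar> \<le> k \<bar>u\<bar>"
      by (intro mono) auto
    then show ?thesis
      using assms by (smt (verit) mult_nonneg_nonneg)
  qed
  then show ?thesis
    by (simp add: k_def)
qed

text \<open>The power grows by a factor of at most \<open>exp (\<gamma> * l)\<close>. This factor is
  at least 1, so it can also be put on the summand 1 and pulled out of the logarithm.\<close>

lemma ln_one_plus_powr_scale:
  fixes \<gamma> r t l :: real
  assumes "\<gamma> \<ge> 0" "l \<ge> 0" "\<bar>r\<bar> \<le> exp l"
  shows "ln (1 + \<bar>r * t\<bar> powr \<gamma>) - ln (1 + \<bar>t\<bar> powr \<gamma>) \<le> \<gamma> * l"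
proof -
  have "\<bar>r * t\<bar> powr \<gamma> \<le> (exp l * \<bar>t\<bar>) powr \<gamma>"
    using assms by (intro powr_mono2) (auto simp: abs_mult mult_right_mono)
  also have "\<dots> = exp (\<gamma> * l) * \<bar>t\<bar> powr \<gamma>"
    by (simp add: powr_mult exp_powr_real mult.commute)
  finally have "1 + \<bar>r * t\<bar> powr \<gamma> \<le> exp (\<gamma> * l) * (1 + \<bar>t\<bar> powr \<gamma>)"
    using assms unfolding distrib_left by (intro add_mono) auto
  then have "ln (1 + \<bar>r * t\<bar> powr \<gamma>) \<le> ln (exp (\<gamma> * l) * (1 + \<bar>t\<bar> powr \<gamma>))"
    by (subst ln_le_cancel_iff) (auto simp: add_pos_nonneg)
  also have "\<dots> = \<gamma> * l + ln (1 + \<bar>t\<bar> powr \<gamma>)"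
    by (subst ln_mult_pos) (auto simp: add_pos_nonneg)
  finally show ?thesis by simp
qed

section \<open>Consequences of a smooth upper bound on the sensitivity\<close>

lemma smooth_upper_bound_on_nonneg:
  assumes "smooth_upper_bound_on X \<beta> (derivative_sensitivity f) c"
    and "x \<in> X" "f differentiable (at x)"
  shows "c x \<ge> 0"
proof -
  have "bounded_linear (frechet_derivative f (at x))"
    using assms(3) frechet_derivative_works has_derivative_bounded_linear by blast
  then have "0 \<le> derivative_sensitivity f x"
    unfolding derivative_sensitivity_def by (rule onorm_pos_le)
  then show ?thesis
    using assms by (auto simp: smooth_upper_bound_on_def intro: order_trans)
qed

text \<open>This is the mean value inequality on the segment, which convexity keeps inside
  \<open>X\<close>. Smoothness compares \<open>c z\<close> with \<open>c x\<close>, and no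
  \<open>z\<close> on the segment is farther from \<open>x\<close> than \<open>x'\<close>
  is.\<close>

lemma smooth_upper_bound_on_increment:
  fixes f c :: "'a::real_normed_vector \<Rightarrow> real"
  assumes "convex X" and diff: "\<And>x. x \<in> X \<Longrightarrow> f differentiable (at x)" and "\<beta> \<ge> 0"
    and c: "smooth_upper_bound_on X \<beta> (derivative_sensitivity f) c"
    and x: "x \<in> X" "x' \<in> X"
  shows "\<bar>f x' - f x\<bar> \<le> c x * exp (\<beta> * norm (x' - x)) * norm (x' - x)"
proof -
  let ?S = "closed_segment x x'"
  have sub: "?S \<subseteq> X"
    using assms by (simp add: closed_segment_subset)
  have "norm (f x' - f x) \<le> c x * exp (\<beta> * norm (x' - x)) * norm (x' - x)"
  proof (rule differentiable_bound[where S = ?S and f' = "\<lambda>z. frechet_derivative f (at z)"])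
    fix z assume z: "z \<in> ?S"
    then have "z \<in> X" using sub by auto
    then show "(f has_derivative frechet_derivative f (at z)) (at z within ?S)"
      using diff frechet_derivative_works has_derivative_at_withinI by blast
    have "onorm (frechet_derivative f (at z)) \<le> c z"
      using c \<open>z \<in> X\<close> by (auto simp: smooth_upper_bound_on_def derivative_sensitivity_def)
    also have "c z \<le> exp (\<beta> * norm (x - z)) * c x"
      using c \<open>z \<in> X\<close> x by (auto simp: smooth_upper_bound_on_def smooth_on_def)
    also have "norm (x - z) \<le> norm (x' - x)"
      using segment_bound1[OF z] by (simp add: norm_minus_commute)
    then have "exp (\<beta> * norm (x - z)) * c x \<le> exp (\<beta> * norm (x' - x)) * c x"
      using smooth_upper_bound_on_nonneg[OF c x(1) diff[OF x(1)]] \<open>\<beta> \<ge> 0\<close>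
      by (intro mult_right_mono) (auto simp: mult_left_mono)
    finally show "onorm (frechet_derivative f (at z)) \<le> c x * exp (\<beta> * norm (x' - x))"
      by (simp add: mult.commute)
  qed auto
  then show ?thesis by simp
qed

section \<open>Comparing the output densities\<close>

text \<open>The change is split into three: the prefactor \<open>ln s\<close>, the scale inside the
  power at the fixed center \<open>f x'\<close>, and the center at the fixed scale \<open>s\<close>.
  The first two use smoothness of \<open>c\<close>, the third the increment of
  \<open>f\<close>.\<close>

lemma neg_ln_density_step:
  fixes f c :: "'a::real_normed_vector \<Rightarrow> real"
  assumes "convex X" and diff: "\<And>x. x \<in> X \<Longrightarrow> f differentiable (at x)"
    and "\<gamma> \<ge> 1" "b > 0" "\<beta> \<ge> 0"
    and c: "smooth_upper_bound_on X \<beta> (derivative_sensitivity f) c"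
    and pos: "\<And>x. x \<in> X \<Longrightarrow> c x > 0"
    and x: "x \<in> X" "x' \<in> X"
  defines "F \<equiv> \<lambda>y z. ln (c z / b) + ln (1 + \<bar>(y - f z) / (c z / b)\<bar> powr \<gamma>)"
  shows "F y x' - F y x \<le> (\<gamma> * b * exp (\<beta> * norm (x' - x)) + (\<gamma> + 1) * \<beta>) * norm (x' - x)"
proof -
  define d s s' where "d = norm (x' - x)" and "s = c x / b" and "s' = c x' / b"
  have s: "s > 0" "s' > 0"
    using pos x \<open>b > 0\<close> by (auto simp: s_def s'_def)
  have d: "d \<ge> 0" by (simp add: d_def)
  have "c x' \<le> exp (\<beta> * d) * c x" "c x \<le> exp (\<beta> * d) * c x'"
    using c x by (auto simp: smooth_upper_bound_on_def smooth_on_def d_def norm_minus_commute)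
  then have ss': "s' \<le> exp (\<beta> * d) * s" "s \<le> exp (\<beta> * d) * s'"
    using \<open>b > 0\<close> by (auto simp: s_def s'_def divide_right_mono)
  have "ln s' \<le> ln (exp (\<beta> * d) * s)"
    using s ss' by simp
  then have 1: "ln s' - ln s \<le> \<beta> * d"
    using s by (simp add: ln_mult_pos)
  have "ln (1 + \<bar>(s / s') * ((y - f x') / s)\<bar> powr \<gamma>) - ln (1 + \<bar>(y - f x') / s\<bar> powr \<gamma>) \<le> \<gamma> * (\<beta> * d)"
    using s ss' d \<open>\<beta> \<ge> 0\<close> \<open>\<gamma> \<ge> 1\<close> by (intro ln_one_plus_powr_scale) (auto simp: field_simps)
  moreover have "(s / s') * ((y - f x') / s) = (y - f x') / s'"
    using s by simp
  ultimately have 2: "ln (1 + \<bar>(y - f x') / s'\<bar> powr \<gamma>) - ln (1 + \<bar>(y - f x') / s\<bar> powr \<gamma>) \<le> \<gamma> * (\<beta> * d)"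
    by simp
  have "\<bar>(y - f x') / s - (y - f x) / s\<bar> = \<bar>f x' - f x\<bar> / s"
    using s by (simp flip: diff_divide_distrib add: abs_minus_commute)
  also have "\<dots> \<le> (c x * exp (\<beta> * d) * d) / s"
    using smooth_upper_bound_on_increment[OF assms(1) diff \<open>\<beta> \<ge> 0\<close> c x] s
    by (intro divide_right_mono) (auto simp: d_def)
  \<comment> \<open>The scale \<open>s = c x / b\<close> is proportional to the sensitivity bound,
    so \<open>c x\<close> cancels and only \<open>b\<close> remains.\<close>
  also have "\<dots> = b * exp (\<beta> * d) * d"
    using pos[OF x(1)] \<open>b > 0\<close> by (simp add: s_def)
  finally have "\<gamma> * \<bar>(y - f x') / s - (y - f x) / s\<bar> \<le> \<gamma> * (b * exp (\<beta> * d) * d)"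
    using \<open>\<gamma> \<ge> 1\<close> by (intro mult_left_mono) auto
  then have 3: "ln (1 + \<bar>(y - f x') / s\<bar> powr \<gamma>) - ln (1 + \<bar>(y - f x) / s\<bar> powr \<gamma>)
      \<le> \<gamma> * (b * exp (\<beta> * d) * d)"
    using ln_one_plus_powr_lipschitz[OF \<open>\<gamma> \<ge> 1\<close>, of "(y - f x') / s" "(y - f x) / s"] by linarith
  have "F y x' - F y x \<le> \<beta> * d + \<gamma> * (\<beta> * d) + \<gamma> * (b * exp (\<beta> * d) * d)"
    using 1 2 3 unfolding F_def s_def[symmetric] s'_def[symmetric] by linarith
  then show ?thesis
    by (simp add: d_def algebra_simps)
qed

lemma gen_cauchy_density_ratio:
  fixes f c :: "'a::real_normed_vector \<Rightarrow> real"
  assumes "convex X" and diff: "\<And>x. x \<in> X \<Longrightarrow> f differentiable (at x)"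
    and "\<gamma> \<ge> 1" "b > 0" "\<beta> \<ge> 0"
    and c: "smooth_upper_bound_on X \<beta> (derivative_sensitivity f) c"
    and pos: "\<And>x. x \<in> X \<Longrightarrow> c x > 0"
    and x: "x \<in> X" "x' \<in> X" "norm (x - x') = 1"
  shows "gen_cauchy_density \<gamma> ((y - f x) / (c x / b)) / (c x / b)
    \<le> exp ((\<gamma> + 1) * (b + \<beta>)) * (gen_cauchy_density \<gamma> ((y - f x') / (c x' / b)) / (c x' / b))"
proof -
  define Z where "Z = (\<integral>u. 1 / (1 + \<bar>u\<bar> powr \<gamma>) \<partial>lborel)"
  define F where "F z = ln (c z / b) + ln (1 + \<bar>(y - f z) / (c z / b)\<bar> powr \<gamma>)" for z
  define p where "p t = x + t *\<^sub>R (x' - x)" for t :: real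
  have Z: "Z \<ge> 0"
    unfolding Z_def by (intro Bochner_Integration.integral_nonneg) (simp add: add_nonneg_nonneg)
  \<comment> \<open>Here \<open>K h\<close> is
    \<open>\<gamma> * b * exp (\<beta> * h) + (\<gamma> + 1) * \<beta>\<close>, and
    \<open>exp (\<beta> * 0)\<close> is its exponential factor in the limit.\<close>
  have "F (p 1) - F (p 0) \<le> \<gamma> * b * exp (\<beta> * 0) + (\<gamma> + 1) * \<beta>"
  proof (rule increment_le_of_small_steps[where \<phi> = "\<lambda>t. F (p t)"])
    have p: "p t \<in> X" if "0 \<le> t" "t \<le> 1" for t
      using convexD_alt[OF \<open>convex X\<close> x(1,2) that] by (simp add: p_def algebra_simps)
    fix s t :: real assume st: "0 \<le> s" "s < t" "t \<le> 1"
    \<comment> \<open>The endpoints are at distance 1, so the parameter \<open>t\<close> measures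
      length along the segment.\<close>
    have "p t - p s = (t - s) *\<^sub>R (x' - x)"
      by (simp add: p_def algebra_simps)
    then have "norm (p t - p s) = t - s"
      using st x(3) by (simp add: norm_minus_commute)
    then show "F (p t) - F (p s) \<le> (\<gamma> * b * exp (\<beta> * (t - s)) + (\<gamma> + 1) * \<beta>) * (t - s)"
      using neg_ln_density_step[OF assms(1) diff assms(3-5) c pos p[of s] p[of t], of y] st
      by (simp add: F_def)
  qed (intro continuous_intros)
  \<comment> \<open>The limiting bound lies below the stated exponent by exactly
    \<open>b\<close>.\<close>
  moreover have "\<gamma> * b + (\<gamma> + 1) * \<beta> \<le> (\<gamma> + 1) * (b + \<beta>)"
    using \<open>b > 0\<close> by (simp add: algebra_simps)
  ultimately have le: "- F x \<le> (\<gamma> + 1) * (b + \<beta>) + - F x'"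
    by (simp add: p_def)
  have dens: "gen_cauchy_density \<gamma> ((y - f z) / (c z / b)) / (c z / b) = exp (- F z) / Z"
    if "z \<in> X" for z
  proof -
    have "c z / b > 0"
      using pos[OF that] \<open>b > 0\<close> by simp
    moreover have "1 + \<bar>(y - f z) / (c z / b)\<bar> powr \<gamma> > 0"
      by (simp add: add_pos_nonneg)
    ultimately have "exp (F z) = (c z / b) * (1 + \<bar>(y - f z) / (c z / b)\<bar> powr \<gamma>)"
      by (simp only: F_def exp_add exp_ln)
    then show ?thesis
      unfolding gen_cauchy_density_def Z_def[symmetric] exp_minus by (simp add: mult_ac)
  qed
  have "exp (- F x) \<le> exp ((\<gamma> + 1) * (b + \<beta>)) * exp (- F x')"
    using le by (simp flip: exp_add)
  then show ?thesis
    unfolding dens[OF x(1)] dens[OF x(2)] using divide_right_mono[OF _ Z] by fastforce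
qed

section \<open>From densities to probabilities\<close>

theorem theorem3:
  fixes X :: "'a::banach set"
    and f c :: "'a \<Rightarrow> real"
    and \<gamma> b \<beta> \<epsilon> :: real
    and M :: "'w measure"
    and \<eta> :: "'w \<Rightarrow> real"
  assumes "open X" and "convex X"
    and "\<And>x. x \<in> X \<Longrightarrow> f differentiable (at x)"
    and "\<gamma> > 1" and "b > 0" and "\<beta> \<ge> 0"
    and "\<epsilon> = (\<gamma> + 1) * (b + \<beta>)"
    and "prob_space M"
    and "distributed M lborel \<eta> (gen_cauchy_density \<gamma>)"
    and "smooth_upper_bound_on X \<beta> (derivative_sensitivity f) c"
  shows "differentially_private X (\<lambda>x x'. norm (x - x')) \<epsilon>
           (\<lambda>x. distr M borel (\<lambda>\<omega>. f x + c x / b * \<eta> \<omega>))"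
proof -
  interpret prob_space M by fact
  note diff = assms(3) and c = assms(10)
  have \<eta>: "\<eta> \<in> borel_measurable M"
    using distributed_measurable[OF assms(9)] by simp
  let ?g = "\<lambda>x. distr M borel (\<lambda>\<omega>. f x + c x / b * \<eta> \<omega>)"
  have meas: "(\<lambda>\<omega>. f x + c x / b * \<eta> \<omega>) \<in> borel_measurable M" for x
    using \<eta> by measurable
  have "measure (?g x) Y \<le> exp \<epsilon> * measure (?g x') Y"
    if Y: "Y \<in> sets borel" and x: "x \<in> X" "x' \<in> X" "norm (x - x') = 1" for x x' Y
  proof (cases "\<exists>z\<in>X. c z = 0")
    \<comment> \<open>With zero scale the output is deterministic and has no density. One zero of
      \<open>c\<close> spreads to all of \<open>X\<close> by smoothness, which forces
      \<open>f x' = f x\<close> and makes the two laws equal.\<close>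
    case True
    then obtain z where z: "z \<in> X" "c z = 0" by blast
    have c0: "c w = 0" if "w \<in> X" for w
    proof -
      have "c w \<le> exp (\<beta> * norm (z - w)) * c z"
        using c z(1) that by (auto simp: smooth_upper_bound_on_def smooth_on_def)
      then show ?thesis
        using z smooth_upper_bound_on_nonneg[OF c that diff[OF that]] by simp
    qed
    have "f x' = f x"
      using smooth_upper_bound_on_increment[OF assms(2) diff assms(6) c x(1,2)] c0[OF x(1)] by simp
    then have "?g x = ?g x'"
      using c0 x by simp
    moreover have "1 \<le> exp \<epsilon>"
      using assms by simp
    ultimately show ?thesis
      by (metis measure_nonneg mult_le_cancel_right1 not_less)
  next
    case False
    then have pos: "c z > 0" if "z \<in> X" for z
      using smooth_upper_bound_on_nonneg[OF c that diff[OF that]] that by (auto simp: less_le)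
    \<comment> \<open>The density of the output at \<open>z\<close>: the affine change of variables
      contributes the factor \<open>1 / (c z / b)\<close>.\<close>
    define q where "q z y = gen_cauchy_density \<gamma> ((y - f z) / (c z / b)) / (c z / b)" for z y
    have em: "emeasure (?g z) Y = (\<integral>\<^sup>+y. ennreal (q z y) * indicator Y y \<partial>lborel)"
      and q: "q z \<in> borel_measurable borel" if "z \<in> X" for z
    proof -
      have s: "c z / b > 0"
        using pos[OF that] \<open>b > 0\<close> by simp
      have "distributed M lborel (\<lambda>\<omega>. f z + c z / b * \<eta> \<omega>)
          (\<lambda>y. ennreal (gen_cauchy_density \<gamma> ((y - f z) / (c z / b))) / \<bar>c z / b\<bar>)"
        using s by (intro distributed_affine[OF assms(9)]) auto
      moreover have "0 \<le> gen_cauchy_density \<gamma> t" for t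
        unfolding gen_cauchy_density_def
        by (intro divide_nonneg_nonneg Bochner_Integration.integral_nonneg) (auto simp: add_nonneg_nonneg)
      ultimately have D: "distributed M lborel (\<lambda>\<omega>. f z + c z / b * \<eta> \<omega>) (\<lambda>y. ennreal (q z y))"
        using s by (simp only: q_def divide_ennreal abs_of_pos)
      show "emeasure (?g z) Y = (\<integral>\<^sup>+y. ennreal (q z y) * indicator Y y \<partial>lborel)"
        using distributed_emeasure[OF D] Y meas by (subst emeasure_distr) auto
      show "q z \<in> borel_measurable borel"
        unfolding q_def[abs_def] gen_cauchy_density_def[abs_def] by measurable
    qed
    \<comment> \<open>The pointwise density ratio is integrated over \<open>Y\<close> in extended
      nonnegative reals; finiteness of both laws then returns the inequality to
      \<open>measure\<close>.\<close>
    have "emeasure (?g x) Y \<le> (\<integral>\<^sup>+y. ennreal (exp \<epsilon>) * (ennreal (q x' y) * indicator Y y) \<partial>lborel)"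
      unfolding em[OF x(1)]
    proof (rule nn_integral_mono)
      fix y :: real
      have "q x y \<le> exp \<epsilon> * q x' y"
        unfolding q_def assms(7) using assms pos x by (intro gen_cauchy_density_ratio[where X = X]) auto
      then show "ennreal (q x y) * indicator Y y \<le> ennreal (exp \<epsilon>) * (ennreal (q x' y) * indicator Y y)"
        by (simp add: ennreal_leI ennreal_mult'[symmetric] split: split_indicator)
    qed
    also have "\<dots> = ennreal (exp \<epsilon>) * emeasure (?g x') Y"
      unfolding em[OF x(2)] using q[OF x(2)] Y by (intro nn_integral_cmult) auto
    finally have "ennreal (measure (?g x) Y) \<le> ennreal (exp \<epsilon> * measure (?g x') Y)"
      using prob_space_distr[OF meas] by (simp add: finite_measure.emeasure_eq_measure prob_space.finite_measure ennreal_mult')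
    then show ?thesis
      by (simp add: ennreal_le_iff)
  qed
  then show ?thesis
    unfolding differentially_private_def using prob_space_distr[OF meas] by simp
qed

end
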